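(* Let $m\geq 2$, let $0<\alpha_1<\cdots<\alpha_m<1$ and let $\epsilon\in(0,1)$. Suppose the random vector of p-values $p=(p_1,\ldots,p_m)$ has a joint distribution with support $[0,1]^m$ and multivariate density $f_p$ such that for all $\delta>0$ there exists $\kappa>0$ with $f_p>\kappa$ on $[\delta,1-\delta]^m$. Suppose moreover that the marginal distribution function $F$ of $p_m$ has derivative satisfying $F'(\alpha_m)>0$, and that for a suitable $\gamma>0$ there exists a constant $d>0$ such that $F'(x)\geq d$ for all $x\in(\alpha_m,\alpha_m+\gamma)$. Consider any sequential Monte Carlo algorithm which computes decisions of the step-up procedure with thresholds $\alpha_1,\ldots,\alpha_m$ and which has a guarantee of correctness of $1-\epsilon$. For $k\in\{1,\ldots,m\}$ let $\tau$ be the number of Monte Carlo simulations the algorithm draws until it has issued decisions on at least $k$ of the $m$ hypotheses ($\tau=\infty$ if this never happens). Then $\mathbb{E}(\tau)=\infty$ for every $k\in\{1,\ldots,m\}$; that is, no such algorithm has a finite expected runtime for any number of decisions.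
   Context: Hypotheses $H_{01},\ldots,H_{0m}$ have p-values $p_1,\ldots,p_m$, which are unknown to the algorithm. A sequential Monte Carlo algorithm approximates the p-values by drawing Monte Carlo simulations: at each step it selects (depending on past observations and possibly auxiliary randomness) a hypothesis $i$ and, conditionally on $p$, observes an independent Bernoulli($p_i$) variable. It may at any time issue a decision (rejection or non-rejection) on a hypothesis. Step-up procedure: let $p_{(1)}\leq\cdots\leq p_{(m)}$ be the ordered p-values and $k^*=\max\{j: p_{(j)}\leq\alpha_j\}$; the hypotheses belonging to $p_{(1)},\ldots,p_{(k^* )}$ are rejected and all others are non-rejected (no hypothesis is rejected if no such $j$ exists). Guarantee of correctness of $1-\epsilon$: for every fixed value of $p\in[0,1]^m$, the probability (over the Monte Carlo simulations and auxiliary randomness) that the algorithm issues at least one decision which disagrees with the decision of the step-up procedure applied to the true p-values $p$ is at most $\epsilon$. The expectation $\mathbb{E}(\tau)$ is taken over both the random p-values $p$ and the simulations.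
   Formalization: The error bound is restricted to ε in (0,1/2) instead of (0,1): for ε ≥ 1/2 the claim is false, since deciding one hypothesis by a fair coin flip has the guarantee of correctness 1−ε and needs no simulations for k=1. *)

theory Defs
  imports "HOL-Probability.Probability"
begin

text \<open>
  Hypotheses are indexed by \<open>{1..m}\<close>; a vector of p-values is a function \<open>p\<close> of which only the
  values on \<open>{1..m}\<close> matter. The decision \<open>True\<close> means rejection, \<open>False\<close> means non-rejection.
\<close>

subsection \<open>Step-up procedure\<close>

definition ordered_pvalue :: "nat \<Rightarrow> (nat \<Rightarrow> real) \<Rightarrow> nat \<Rightarrow> real" where
  "ordered_pvalue m p j = sort (map p [1..<Suc m]) ! (j - 1)"

text \<open>The value 0 encodes that no \<open>j\<close> with \<open>p\<^bsub>(j)\<^esub> \<le> \<alpha>\<^sub>j\<close> exists.\<close>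

definition stepup_index :: "nat \<Rightarrow> (nat \<Rightarrow> real) \<Rightarrow> (nat \<Rightarrow> real) \<Rightarrow> nat" where
  "stepup_index m \<alpha> p = Max (insert 0 {j \<in> {1..m}. ordered_pvalue m p j \<le> \<alpha> j})"

text \<open>
  Ties are harmless: for increasing thresholds, \<open>p\<^bsub>(k)\<^esub> < p\<^bsub>(k+1)\<^esub>\<close> at the step-up index \<open>k < m\<close>.
\<close>

definition stepup_rejected :: "nat \<Rightarrow> (nat \<Rightarrow> real) \<Rightarrow> (nat \<Rightarrow> real) \<Rightarrow> nat set" where
  "stepup_rejected m \<alpha> p =
     {i \<in> {1..m}. \<exists>j \<in> {1..stepup_index m \<alpha> p}. p i = ordered_pvalue m p j}"

subsection \<open>Sequential Monte Carlo algorithms\<close>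

text \<open>
  A history lists, oldest first, the sampled hypotheses together with the observed outcomes.
  The probability space \<open>U\<close> carries all auxiliary randomness of the algorithm. After history \<open>h\<close>,
  the algorithm issues the decisions \<open>dec u h i\<close> (\<open>None\<close>: no decision on \<open>i\<close> is issued at this
  point), and then samples hypothesis \<open>sel u h\<close>. An algorithm that stops sampling can be
  represented by one that goes on sampling without issuing further decisions.
\<close>

type_synonym history = "(nat \<times> bool) list"

definition mc_algorithm ::
  "nat \<Rightarrow> 'u measure \<Rightarrow> ('u \<Rightarrow> history \<Rightarrow> nat) \<Rightarrow> ('u \<Rightarrow> history \<Rightarrow> nat \<Rightarrow> bool option) \<Rightarrow> bool" where
  "mc_algorithm m U sel dec \<longleftrightarrow>
     prob_space U \<and>
     (\<forall>h. (\<lambda>u. sel u h) \<in> measurable U (count_space {1..m})) \<and>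
     (\<forall>h. \<forall>i \<in> {1..m}. (\<lambda>u. dec u h i) \<in> measurable U (count_space UNIV))"

text \<open>
  The coordinate \<open>(n, i)\<close> of a simulation is the outcome of the draw at step \<open>n\<close> should hypothesis
  \<open>i\<close> be selected then. It is independent of the history up to step \<open>n\<close>, of \<open>U\<close>, and of all
  other coordinates.
\<close>

definition run_space :: "nat \<Rightarrow> 'u measure \<Rightarrow> (nat \<Rightarrow> real) \<Rightarrow> ('u \<times> (nat \<times> nat \<Rightarrow> bool)) measure" where
  "run_space m U p =
     U \<Otimes>\<^sub>M (\<Pi>\<^sub>M ni \<in> UNIV \<times> {1..m}. measure_pmf (bernoulli_pmf (p (snd ni))))"

primrec hist :: "('u \<Rightarrow> history \<Rightarrow> nat) \<Rightarrow> 'u \<times> (nat \<times> nat \<Rightarrow> bool) \<Rightarrow> nat \<Rightarrow> history" where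
  "hist sel y 0 = []"
| "hist sel y (Suc n) =
     (let h = hist sel y n; i = sel (fst y) h in h @ [(i, snd y (n, i))])"

definition decided ::
  "nat \<Rightarrow> ('u \<Rightarrow> history \<Rightarrow> nat) \<Rightarrow> ('u \<Rightarrow> history \<Rightarrow> nat \<Rightarrow> bool option) \<Rightarrow>
   'u \<times> (nat \<times> nat \<Rightarrow> bool) \<Rightarrow> nat \<Rightarrow> nat set" where
  "decided m sel dec y n = {i \<in> {1..m}. \<exists>l \<le> n. dec (fst y) (hist sel y l) i \<noteq> None}"

text \<open>In \<^typ>\<open>enat\<close>, the infimum of the empty set is \<open>\<infinity>\<close>.\<close>

definition runtime ::
  "nat \<Rightarrow> ('u \<Rightarrow> history \<Rightarrow> nat) \<Rightarrow> ('u \<Rightarrow> history \<Rightarrow> nat \<Rightarrow> bool option) \<Rightarrow>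
   nat \<Rightarrow> 'u \<times> (nat \<times> nat \<Rightarrow> bool) \<Rightarrow> enat" where
  "runtime m sel dec k y = (INF n \<in> {n. k \<le> card (decided m sel dec y n)}. enat n)"

definition wrong_decision ::
  "nat \<Rightarrow> (nat \<Rightarrow> real) \<Rightarrow> (nat \<Rightarrow> real) \<Rightarrow> ('u \<Rightarrow> history \<Rightarrow> nat) \<Rightarrow>
   ('u \<Rightarrow> history \<Rightarrow> nat \<Rightarrow> bool option) \<Rightarrow> 'u \<times> (nat \<times> nat \<Rightarrow> bool) \<Rightarrow> bool" where
  "wrong_decision m \<alpha> p sel dec y \<longleftrightarrow>
     (\<exists>n. \<exists>i \<in> {1..m}. dec (fst y) (hist sel y n) i = Some (i \<notin> stepup_rejected m \<alpha> p))"

definition correctness_guarantee ::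
  "nat \<Rightarrow> (nat \<Rightarrow> real) \<Rightarrow> real \<Rightarrow> 'u measure \<Rightarrow> ('u \<Rightarrow> history \<Rightarrow> nat) \<Rightarrow>
   ('u \<Rightarrow> history \<Rightarrow> nat \<Rightarrow> bool option) \<Rightarrow> bool" where
  "correctness_guarantee m \<alpha> \<epsilon> U sel dec \<longleftrightarrow>
     (\<forall>p. (\<forall>i \<in> {1..m}. p i \<in> {0..1}) \<longrightarrow>
        measure (run_space m U p)
          {y \<in> space (run_space m U p). wrong_decision m \<alpha> p sel dec y} \<le> \<epsilon>)"

text \<open>
  Expectation of the runtime over the random p-values \<open>P\<close> (defined on \<open>M\<close>), the simulations and
  the auxiliary randomness; \<open>run_space m U p\<close> is the conditional law of the latter two given
  \<open>P = p\<close>.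
\<close>

definition expected_runtime ::
  "nat \<Rightarrow> 'a measure \<Rightarrow> ('a \<Rightarrow> nat \<Rightarrow> real) \<Rightarrow> 'u measure \<Rightarrow> ('u \<Rightarrow> history \<Rightarrow> nat) \<Rightarrow>
   ('u \<Rightarrow> history \<Rightarrow> nat \<Rightarrow> bool option) \<Rightarrow> nat \<Rightarrow> ennreal" where
  "expected_runtime m M P U sel dec k =
     (\<integral>\<^sup>+ \<omega>. (\<integral>\<^sup>+ y. ennreal_of_enat (runtime m sel dec k y) \<partial>run_space m U (P \<omega>)) \<partial>M)"

subsection \<open>Support of a distribution\<close>

definition measure_support :: "'b topology \<Rightarrow> 'b measure \<Rightarrow> 'b set" where
  "measure_support T D = {x \<in> topspace T. \<forall>V. openin T V \<and> x \<in> V \<longrightarrow> 0 < emeasure D V}"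

subsection \<open>Large error bounds\<close>

text \<open>
  For \<open>\<epsilon> \<ge> 1/2\<close>, deciding one hypothesis by a fair coin flip and doing nothing else has the
  correctness guarantee and never needs a simulation. Hence the runtime to the first decision
  can only have infinite expectation for every such algorithm if \<open>\<epsilon> < 1/2\<close>.
\<close>

lemma coin_flip_correctness_guarantee:
  fixes m :: nat and \<alpha> :: "nat \<Rightarrow> real" and \<epsilon> :: real
  assumes "1 \<le> m" "1 / 2 \<le> \<epsilon>"
  defines "U \<equiv> measure_pmf (bernoulli_pmf (1 / 2))"
  defines "dec \<equiv> \<lambda>u (h :: history) i. if i = 1 then Some u else None"
  shows "mc_algorithm m U (\<lambda>u h. 1) dec"
    and "correctness_guarantee m \<alpha> \<epsilon> U (\<lambda>u h. 1) dec"
    and "runtime m (\<lambda>u h. 1) dec 1 y = 0"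
    and "expected_runtime m M P U (\<lambda>u h. 1) dec 1 = 0"
proof -
  show "mc_algorithm m U (\<lambda>u h. 1) dec"
    using assms(1) by (auto simp: mc_algorithm_def U_def intro: measure_pmf.prob_space_axioms)
  have "decided m (\<lambda>u h. 1) dec y n = {1}" for y n
    using assms(1) by (auto simp: decided_def dec_def)
  then have "runtime m (\<lambda>u h. 1) dec 1 y = (INF n. enat n)" for y
    by (simp add: runtime_def)
  moreover have "(INF n. enat n) \<le> enat 0"
    by (rule INF_lower) simp
  ultimately have r: "runtime m (\<lambda>u h. 1) dec 1 y = 0" for y
    by (metis le_zero_eq zero_enat_def)
  show "runtime m (\<lambda>u h. 1) dec 1 y = 0" by (rule r)
  show "expected_runtime m M P U (\<lambda>u h. 1) dec 1 = 0"
    using r by (simp add: expected_runtime_def)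
  show "correctness_guarantee m \<alpha> \<epsilon> U (\<lambda>u h. 1) dec"
    unfolding correctness_guarantee_def
  proof (intro allI impI)
    fix p :: "nat \<Rightarrow> real"
    let ?S = "\<Pi>\<^sub>M ni \<in> UNIV \<times> {1..m}. measure_pmf (bernoulli_pmf (p (snd ni)))"
    let ?w = "1 \<notin> stepup_rejected m \<alpha> p"
    interpret S: prob_space ?S
      by (intro prob_space_PiM measure_pmf.prob_space_axioms)
    have "{y \<in> space (run_space m U p). wrong_decision m \<alpha> p (\<lambda>u h. 1) dec y} = {?w} \<times> space ?S"
      using assms(1)
      by (auto simp: run_space_def U_def wrong_decision_def dec_def space_pair_measure
          split: if_splits)
    moreover have "emeasure (run_space m U p) ({?w} \<times> space ?S) = emeasure U {?w}"
      unfolding run_space_def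
      by (subst S.emeasure_pair_measure_Times)
        (simp_all only: U_def S.emeasure_space_1 sets_measure_pmf UNIV_I sets.top mult_1_right)
    moreover have "emeasure U {?w} = ennreal (1 / 2)"
      unfolding U_def by (cases ?w) (auto simp: emeasure_pmf_single)
    ultimately show "measure (run_space m U p)
        {y \<in> space (run_space m U p). wrong_decision m \<alpha> p (\<lambda>u h. 1) dec y} \<le> \<epsilon>"
      using assms(2) enn2real_ennreal[of "1 / 2"] by (simp only: measure_def)
  qed
qed

end

theory Submission
  imports Defs
begin

text \<open>
  The runtime is infinite in expectation because p-values just below \<open>\<alpha>\<^sub>m\<close> are too likely. If all
  p-values lie strictly between \<open>\<alpha>\<^bsub>m-1\<^esub>\<close> and \<open>\<alpha>\<^sub>m\<close>, then every hypothesis is rejected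
  (\<open>stepup_rejected_all\<close>). Reflecting the single p-value \<open>p\<^sub>m = \<alpha>\<^sub>m - \<delta>\<close> to \<open>\<alpha>\<^sub>m + \<delta>\<close> makes the
  step-up procedure reject nothing at all (\<open>stepup_rejected_none\<close>). So whichever hypothesis
  is decided first, and in whichever direction, one of these two parameter vectors makes the
  decision wrong, and even a single decision requires telling the two vectors apart.

  Distinguishing them takes of the order of \<open>1 / \<delta>\<close> draws at least. Let a common family of uniform
  variables drive the simulations for all parameter vectors at once. A given draw then differs
  between the two vectors with probability at most \<open>2\<delta>\<close>, so an event determined by the first
  \<open>n\<close> draws changes its probability by at most \<open>2n\<delta>\<close> (\<open>prob_le_after_few_draws\<close>). The correctness
  guarantee, applied once at each vector, bounds the probability of any decision before the
  draw \<open>n + 1\<close> by \<open>2\<epsilon> + 2n\<delta>\<close>. As \<open>\<epsilon> < 1 / 2\<close>, this stays away from 1 for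
  \<open>n\<close> up to a constant over \<open>\<delta>\<close>, hence the expected runtime given the p-values is at least a
  constant over \<open>\<alpha>\<^sub>m - p\<^sub>m\<close> (\<open>expected_runtime_given_pvalues_ge\<close>).

  The density of the p-values is bounded below on a box \<open>[a, \<alpha>\<^sub>m)\<^sup>m\<close>, and the integral of
  \<open>1 / (\<alpha>\<^sub>m - x)\<close> over \<open>[a, \<alpha>\<^sub>m)\<close> diverges (\<open>nn_integral_inverse_distance\<close>). A sharper
  information bound would give the order \<open>1 / \<delta>\<^sup>2\<close>, but \<open>1 / \<delta>\<close> already fails to be integrable.
\<close>

section \<open>Coupling the simulations for different p-values\<close>

lemma distr_PiM_componentwise:
  assumes M: "\<And>i. i \<in> I \<Longrightarrow> prob_space (M i)"
    and f: "\<And>i. i \<in> I \<Longrightarrow> f i \<in> measurable (M i) (N i)"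
  shows "distr (Pi\<^sub>M I M) (Pi\<^sub>M I N) (\<lambda>\<omega>. \<lambda>i\<in>I. f i (\<omega> i)) = (\<Pi>\<^sub>M i\<in>I. distr (M i) (N i) (f i))"
    (is "distr ?M ?N ?f = ?D")
proof (rule measure_eqI_PiM_infinite[where M = "\<lambda>i. distr (M i) (N i) (f i)"])
  have meas: "?f \<in> measurable ?M ?N"
    by (intro measurable_restrict measurable_compose[OF measurable_component_singleton]) (auto intro: f)
  interpret M: prob_space ?M
    by (intro prob_space_PiM M)
  show "finite_measure (distr ?M ?N ?f)"
    by (intro M.finite_measure_distr meas)
  show "sets (distr ?M ?N ?f) = sets ?D"
    by (simp only: sets_distr) (rule sets_PiM_cong, simp_all)
  fix A J
  assume J: "finite J" "J \<subseteq> I" and "\<And>i. i \<in> J \<Longrightarrow> A i \<in> sets (distr (M i) (N i) (f i))"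
  then have A: "A i \<in> sets (N i)" if "i \<in> J" for i
    using that by simp
  have emb: "prod_emb I (\<lambda>i. distr (M i) (N i) (f i)) J (Pi\<^sub>E J A) = prod_emb I N J (Pi\<^sub>E J A)"
    by (simp add: prod_emb_def)
  have "?f w \<in> prod_emb I N J (Pi\<^sub>E J A) \<longleftrightarrow> w \<in> prod_emb I M J (\<Pi>\<^sub>E i\<in>J. f i -` A i \<inter> space (M i))"
    if "w \<in> space ?M" for w
    using that J measurable_space[OF meas that]
    by (auto simp: prod_emb_def space_PiM PiE_iff subset_iff)
  moreover have "prod_emb I M J (\<Pi>\<^sub>E i\<in>J. f i -` A i \<inter> space (M i)) \<subseteq> space ?M"
    by (auto simp: prod_emb_def space_PiM)
  ultimately have "?f -` prod_emb I N J (Pi\<^sub>E J A) \<inter> space ?M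
      = prod_emb I M J (\<Pi>\<^sub>E i\<in>J. f i -` A i \<inter> space (M i))"
    by blast
  then have "emeasure (distr ?M ?N ?f) (prod_emb I N J (Pi\<^sub>E J A))
      = emeasure ?M (prod_emb I M J (\<Pi>\<^sub>E i\<in>J. f i -` A i \<inter> space (M i)))"
    using J A by (subst emeasure_distr[OF meas]) (auto intro!: sets_PiM_I)
  also have "\<dots> = (\<Prod>i\<in>J. emeasure (M i) (f i -` A i \<inter> space (M i)))"
    using J A f by (intro emeasure_PiM_emb M measurable_sets) auto
  also have "\<dots> = (\<Prod>i\<in>J. emeasure (distr (M i) (N i) (f i)) (A i))"
    using J A f by (intro prod.cong refl emeasure_distr[symmetric]) auto
  also have "\<dots> = emeasure ?D (prod_emb I N J (Pi\<^sub>E J A))"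
    unfolding emb[symmetric] using J A M f
    by (intro emeasure_PiM_emb[symmetric] prob_space.prob_space_distr) auto
  finally show "emeasure (distr ?M ?N ?f) (prod_emb I (\<lambda>i. distr (M i) (N i) (f i)) J (Pi\<^sub>E J A))
      = emeasure ?D (prod_emb I (\<lambda>i. distr (M i) (N i) (f i)) J (Pi\<^sub>E J A))"
    unfolding emb .
qed simp

text \<open>
  A uniform variable \<open>w\<close> realises Bernoulli variables for all success probabilities
  simultaneously, as the events \<open>w < p\<close>. Two of them differ only if \<open>w\<close> falls between the
  two probabilities.
\<close>

abbreviation unit_uniform :: "real measure" where
  "unit_uniform \<equiv> uniform_measure lborel {0..1}"

lemma prob_space_unit_uniform: "prob_space unit_uniform"
  by (rule prob_space_uniform_measure) auto

lemma emeasure_unit_uniform_Ico: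
  assumes "0 \<le> a" "a \<le> b" "b \<le> 1"
  shows "emeasure unit_uniform {a..<b} = ennreal (b - a)"
proof -
  have "{0..1} \<inter> {a..<b} = {a..<b}"
    using assms by auto
  then show ?thesis
    using assms divide_ennreal[of "b - a" 1] by simp
qed

lemma distr_unit_uniform_less:
  assumes "p \<in> {0..1}"
  shows "distr unit_uniform (measure_pmf (bernoulli_pmf p)) (\<lambda>w. w < p)
    = measure_pmf (bernoulli_pmf p)" (is "distr ?u _ ?f = ?B")
proof (rule measure_eqI_countable[where A = UNIV])
  have meas: "?f \<in> measurable ?u ?B"
    by (simp add: measurable_pmf_measure2)
  fix b :: bool
  have eq: "?f -` {b} = (if b then {..<p} else {p..})"
    by (cases b) (simp_all add: vimage_def lessThan_def atLeast_def not_less)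
  have "{0..1} \<inter> {..<p} = {0..<p}" "{0..1} \<inter> {p..} = {p..1}"
    using assms by auto
  then have "emeasure lborel ({0..1} \<inter> ?f -` {b}) = emeasure ?B {b}"
    unfolding eq using assms by (cases b) (simp_all add: emeasure_pmf_single)
  moreover have "?f -` {b} \<in> sets borel"
    unfolding eq by simp
  ultimately have "emeasure ?u (?f -` {b}) = emeasure ?B {b} / 1"
    by simp
  also have "\<dots> = emeasure ?B {b}"
    using divide_ennreal[of "measure ?B {b}" 1] by (simp only: measure_pmf.emeasure_eq_measure) simp
  finally show "emeasure (distr ?u ?B ?f) {b} = emeasure ?B {b}"
    by (subst emeasure_distr[OF meas]) simp_all
qed auto

definition noise_space :: "nat \<Rightarrow> 'u measure \<Rightarrow> ('u \<times> (nat \<times> nat \<Rightarrow> real)) measure" where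
  "noise_space m U = U \<Otimes>\<^sub>M (\<Pi>\<^sub>M ni \<in> UNIV \<times> {1..m}. unit_uniform)"

definition simulate ::
  "nat \<Rightarrow> (nat \<Rightarrow> real) \<Rightarrow> 'u \<times> (nat \<times> nat \<Rightarrow> real) \<Rightarrow> 'u \<times> (nat \<times> nat \<Rightarrow> bool)" where
  "simulate m p = (\<lambda>(u, w). (u, \<lambda>ni \<in> UNIV \<times> {1..m}. w ni < p (snd ni)))"

lemma measurable_simulate: "simulate m p \<in> measurable (noise_space m U) (run_space m U p)"
  unfolding simulate_def noise_space_def run_space_def
  by (auto simp: split_beta' measurable_pmf_measure2 intro!: measurable_Pair measurable_restrict
      measurable_compose[OF measurable_snd measurable_compose[OF measurable_component_singleton]])

lemma prob_space_noise_space: "prob_space U \<Longrightarrow> prob_space (noise_space m U)"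
  unfolding noise_space_def
  by (intro prob_space_pair prob_space_PiM prob_space_unit_uniform)

lemma prob_space_run_space: "prob_space U \<Longrightarrow> prob_space (run_space m U p)"
  unfolding run_space_def
  by (intro prob_space_pair prob_space_PiM measure_pmf.prob_space_axioms)

lemma run_space_eq_distr_simulate:
  assumes U: "prob_space U" and p: "\<And>i. i \<in> {1..m} \<Longrightarrow> p i \<in> {0..1}"
  shows "run_space m U p = distr (noise_space m U) (run_space m U p) (simulate m p)"
proof -
  let ?I = "UNIV \<times> {1..m} :: (nat \<times> nat) set"
  let ?B = "\<Pi>\<^sub>M ni \<in> ?I. measure_pmf (bernoulli_pmf (p (snd ni)))"
  let ?W = "\<Pi>\<^sub>M ni \<in> ?I. unit_uniform"
  let ?g = "\<lambda>w. \<lambda>ni\<in>?I. w ni < p (snd ni)"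
  have g: "?g \<in> measurable ?W ?B"
    by (auto simp: measurable_pmf_measure2 intro!: measurable_restrict
        measurable_compose[OF measurable_component_singleton])
  have "distr ?W ?B ?g = (\<Pi>\<^sub>M ni \<in> ?I. distr unit_uniform
      (measure_pmf (bernoulli_pmf (p (snd ni)))) (\<lambda>w. w < p (snd ni)))"
    by (rule distr_PiM_componentwise)
      (auto simp: measurable_pmf_measure2 intro: prob_space_unit_uniform)
  also have "\<dots> = ?B"
    by (intro PiM_cong refl distr_unit_uniform_less) (use p in auto)
  finally have B: "distr ?W ?B ?g = ?B" .
  have "sigma_finite_measure (distr ?W ?B ?g)"
    unfolding B by (intro prob_space_imp_sigma_finite prob_space_PiM measure_pmf.prob_space_axioms)
  from pair_measure_distr[OF measurable_ident g this, of U]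
  have "U \<Otimes>\<^sub>M ?B = distr (U \<Otimes>\<^sub>M ?W) (U \<Otimes>\<^sub>M ?B) (\<lambda>(u, w). (u, ?g w))"
    unfolding B by (simp add: distr_id id_def)
  then show ?thesis
    by (simp only: run_space_def noise_space_def simulate_def)
qed

text \<open>
  The total variation bound. On the coupled space the runs for \<open>p\<close> and \<open>q\<close> coincide up to draw
  \<open>n\<close> unless one of the relevant uniform variables falls between \<open>p\<^sub>i\<close> and \<open>q\<^sub>i\<close>; a union
  bound over these events, which are the sets \<open>D\<close> below, gives the claim. Comparing the
  potential outcomes of all hypotheses at all steps makes the bound uniform in the sampling rule.
\<close>

lemma prob_le_after_few_draws:
  assumes U: "prob_space U"
    and p: "\<And>i. i \<in> {1..m} \<Longrightarrow> p i \<in> {0..1}" and q: "\<And>i. i \<in> {1..m} \<Longrightarrow> q i \<in> {0..1}"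
    and Q: "\<And>r. {y \<in> space (run_space m U r). Q y} \<in> sets (run_space m U r)"
    and local: "\<And>u x x'. u \<in> space U \<Longrightarrow> (\<And>l i. l < n \<Longrightarrow> i \<in> {1..m} \<Longrightarrow> x (l, i) = x' (l, i))
      \<Longrightarrow> Q (u, x) \<Longrightarrow> Q (u, x')"
  shows "measure (run_space m U p) {y \<in> space (run_space m U p). Q y}
    \<le> measure (run_space m U q) {y \<in> space (run_space m U q). Q y}
      + real n * (\<Sum>i\<in>{1..m}. \<bar>p i - q i\<bar>)"
proof -
  interpret V: prob_space "noise_space m U"
    by (rule prob_space_noise_space[OF U])
  let ?V = "noise_space m U"
  define I where "I i = {min (p i) (q i)..<max (p i) (q i)}" for i
  define S where "S r = {v \<in> space ?V. Q (simulate m r v)}" for r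
  define D where "D = (\<lambda>(l, i). {v \<in> space ?V. snd v (l, i) \<in> I i})"
  have pull: "measure (run_space m U r) {y \<in> space (run_space m U r). Q y} = measure ?V (S r)"
    and S: "S r \<in> sets ?V"
    if r: "\<And>i. i \<in> {1..m} \<Longrightarrow> r i \<in> {0..1}" for r
  proof -
    have eq: "simulate m r -` {y \<in> space (run_space m U r). Q y} \<inter> space ?V = S r"
      using measurable_space[OF measurable_simulate, of _ m U r] by (auto simp: S_def)
    show "measure (run_space m U r) {y \<in> space (run_space m U r). Q y} = measure ?V (S r)"
    proof -
      have "measure (distr ?V (run_space m U r) (simulate m r)) {y \<in> space (run_space m U r). Q y} = measure ?V (S r)"
        unfolding eq[symmetric] by (rule measure_distr[OF measurable_simulate Q])
      then show ?thesis
        using run_space_eq_distr_simulate[OF U r] by simp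
    qed
    show "S r \<in> sets ?V"
      unfolding eq[symmetric] by (rule measurable_sets[OF measurable_simulate Q])
  qed
  have D: "D (l, i) \<in> sets ?V" "measure ?V (D (l, i)) = \<bar>p i - q i\<bar>" if i: "i \<in> {1..m}" for l i
  proof -
    let ?W = "\<Pi>\<^sub>M ni \<in> UNIV \<times> {1..m}. unit_uniform"
    interpret W: prob_space ?W
      by (intro prob_space_PiM prob_space_unit_uniform)
    have eq: "D (l, i) = space U \<times> ((\<lambda>w. w (l, i)) -` I i \<inter> space ?W)"
      by (auto simp: D_def noise_space_def space_pair_measure)
    have comp: "(\<lambda>w. w (l, i)) \<in> measurable ?W unit_uniform"
      using i by (intro measurable_component_singleton) auto
    have "I i \<in> sets unit_uniform"
      by (simp add: I_def)
    with comp have W: "(\<lambda>w. w (l, i)) -` I i \<inter> space ?W \<in> sets ?W"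
      by (rule measurable_sets)
    then show "D (l, i) \<in> sets ?V"
      unfolding eq noise_space_def by (intro pair_measureI) auto
    have "emeasure ?V (D (l, i)) = emeasure U (space U) * emeasure ?W ((\<lambda>w. w (l, i)) -` I i \<inter> space ?W)"
      unfolding eq noise_space_def using W by (intro W.emeasure_pair_measure_Times) auto
    also have "\<dots> = emeasure (distr ?W unit_uniform (\<lambda>w. w (l, i))) (I i)"
      using comp by (simp add: prob_space.emeasure_space_1[OF U] emeasure_distr I_def)
    also have "\<dots> = emeasure unit_uniform (I i)"
      using i by (subst distr_PiM_component) (auto intro: prob_space_unit_uniform)
    also have "\<dots> = ennreal \<bar>p i - q i\<bar>"
      unfolding I_def using p[OF i] q[OF i] by (subst emeasure_unit_uniform_Ico) (auto simp: min_def max_def)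
    finally show "measure ?V (D (l, i)) = \<bar>p i - q i\<bar>"
      by (simp add: measure_def)
  qed
  have "S p \<subseteq> S q \<union> (\<Union>li\<in>{..<n} \<times> {1..m}. D li)"
  proof safe
    fix u w
    assume v: "(u, w) \<in> S p" and "(u, w) \<notin> (\<Union>li\<in>{..<n} \<times> {1..m}. D li)"
    then have "w (l, i) \<notin> I i" if "l < n" "i \<in> {1..m}" for l i
      using that by (auto simp: D_def S_def)
    then have same: "w (l, i) < p i \<longleftrightarrow> w (l, i) < q i" if "l < n" "i \<in> {1..m}" for l i
      using that unfolding I_def by force
    have "Q (simulate m q (u, w))"
      unfolding simulate_def prod.case
    proof (rule local)
      show "u \<in> space U"
        using v by (auto simp: S_def noise_space_def space_pair_measure)
      show "Q (u, \<lambda>ni \<in> UNIV \<times> {1..m}. w ni < p (snd ni))"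
        using v by (simp add: S_def simulate_def)
    qed (use same in auto)
    then show "(u, w) \<in> S q"
      using v by (simp add: S_def)
  qed
  moreover have D': "D li \<in> sets ?V" if "li \<in> {..<n} \<times> {1..m}" for li
    using that D(1) by (cases li) simp
  then have UN: "(\<Union>li\<in>{..<n} \<times> {1..m}. D li) \<in> sets ?V"
    by (intro sets.finite_UN) auto
  ultimately have "measure ?V (S p) \<le> measure ?V (S q \<union> (\<Union>li\<in>{..<n} \<times> {1..m}. D li))"
    by (intro V.finite_measure_mono sets.Un S[OF q])
  also have "\<dots> \<le> measure ?V (S q) + measure ?V (\<Union>li\<in>{..<n} \<times> {1..m}. D li)"
    by (intro measure_Un_le S[OF q] UN)
  also have "measure ?V (\<Union>li\<in>{..<n} \<times> {1..m}. D li) \<le> (\<Sum>li\<in>{..<n} \<times> {1..m}. measure ?V (D li))"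
    using D' by (intro V.finite_measure_subadditive_finite) auto
  also have "\<dots> = (\<Sum>li\<in>{..<n} \<times> {1..m}. \<bar>p (snd li) - q (snd li)\<bar>)"
    using D(2) by (intro sum.cong) auto
  also have "\<dots> = real n * (\<Sum>i\<in>{1..m}. \<bar>p i - q i\<bar>)"
    by (simp add: sum.cartesian_product' split_beta)
  finally show ?thesis
    using pull[OF p] pull[OF q] by simp
qed

section \<open>Decisions as events of the run\<close>

lemma hist_cong:
  assumes "u \<in> space U" and "mc_algorithm m U sel dec"
    and x: "\<And>l i. l < n \<Longrightarrow> i \<in> {1..m} \<Longrightarrow> x (l, i) = x' (l, i)"
  shows "hist sel (u, x) n = hist sel (u, x') n"
  using x
proof (induction n)
  case (Suc n)
  have "sel u h \<in> {1..m}" for h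
    using assms(1,2) measurable_space[of "\<lambda>u. sel u h" U "count_space {1..m}" u]
    by (simp add: mc_algorithm_def)
  with Suc show ?case
    by (simp add: Let_def)
qed simp

lemma measurable_hist:
  assumes "mc_algorithm m U sel dec"
  shows "(\<lambda>y. hist sel y n) \<in> measurable (run_space m U p) (count_space UNIV)"
proof (induction n)
  case (Suc n)
  let ?R = "run_space m U p"
  have fst: "fst \<in> measurable ?R U"
    unfolding run_space_def by (rule measurable_fst)
  have sel: "(\<lambda>y. sel (fst y) h) \<in> measurable ?R (count_space {1..m})" for h
    by (rule measurable_compose[OF fst]) (use assms in \<open>unfold mc_algorithm_def, blast\<close>)
  have coord: "(\<lambda>y. snd y (n, i)) \<in> measurable ?R (count_space UNIV)" if "i \<in> {1..m}" for i
  proof -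
    have "(\<lambda>x. x (n, i)) \<in> measurable (\<Pi>\<^sub>M ni \<in> UNIV \<times> {1..m}. measure_pmf (bernoulli_pmf (p (snd ni))))
        (measure_pmf (bernoulli_pmf (p (snd (n, i)))))"
      using that by (intro measurable_component_singleton) auto
    then show ?thesis
      unfolding run_space_def measurable_pmf_measure2 by (rule measurable_compose[OF measurable_snd])
  qed
  have "(\<lambda>y. h @ [(i, snd y (n, i))]) \<in> measurable ?R (count_space UNIV)" if "i \<in> {1..m}" for h i
    by (rule measurable_compose[OF coord[OF that]]) simp
  then have "(\<lambda>y. h @ [(sel (fst y) h, snd y (n, sel (fst y) h))]) \<in> measurable ?R (count_space UNIV)" for h
    by (intro measurable_compose_countable'[OF _ sel, where
          f = "\<lambda>i y. h @ [(i, snd y (n, i))]" for h]) auto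
  then have "(\<lambda>y. hist sel y n @ [(sel (fst y) (hist sel y n), snd y (n, sel (fst y) (hist sel y n)))])
      \<in> measurable ?R (count_space UNIV)"
    by (rule measurable_compose_countable[OF _ Suc, where
          f = "\<lambda>h y. h @ [(sel (fst y) h, snd y (n, sel (fst y) h))]"])
  then show ?case
    unfolding hist.simps Let_def .
qed simp

definition issues ::
  "nat \<Rightarrow> ('u \<Rightarrow> history \<Rightarrow> nat) \<Rightarrow> ('u \<Rightarrow> history \<Rightarrow> nat \<Rightarrow> bool option) \<Rightarrow>
   bool \<Rightarrow> 'u \<times> (nat \<times> nat \<Rightarrow> bool) \<Rightarrow> nat \<Rightarrow> bool" where
  "issues m sel dec b y n \<longleftrightarrow> (\<exists>i \<in> {1..m}. dec (fst y) (hist sel y n) i = Some b)"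

lemma sets_issues:
  assumes "mc_algorithm m U sel dec"
  shows "{y \<in> space (run_space m U p). issues m sel dec b y n} \<in> sets (run_space m U p)"
proof -
  let ?R = "run_space m U p"
  have fst: "fst \<in> measurable ?R U"
    by (simp add: run_space_def)
  have "(\<lambda>y. dec (fst y) h i) \<in> measurable ?R (count_space UNIV)" if "i \<in> {1..m}" for h i
    by (rule measurable_compose[OF fst]) (use assms that in \<open>unfold mc_algorithm_def, blast\<close>)
  then have "(\<lambda>y. dec (fst y) (hist sel y n) i) \<in> measurable ?R (count_space UNIV)"
    if "i \<in> {1..m}" for i
    using that by (intro measurable_compose_countable[OF _ measurable_hist[OF assms], where
          f = "\<lambda>h y. dec (fst y) h i" for i])
  then have "(\<lambda>y. dec (fst y) (hist sel y n) i) -` {Some b} \<inter> space ?R \<in> sets ?R" if "i \<in> {1..m}" for i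
    using that by (intro measurable_sets) auto
  then have "(\<Union>i\<in>{1..m}. (\<lambda>y. dec (fst y) (hist sel y n) i) -` {Some b} \<inter> space ?R) \<in> sets ?R"
    by (intro sets.finite_UN) auto
  also have "(\<Union>i\<in>{1..m}. (\<lambda>y. dec (fst y) (hist sel y n) i) -` {Some b} \<inter> space ?R)
      = {y \<in> space ?R. issues m sel dec b y n}"
    by (auto simp: issues_def)
  finally show ?thesis .
qed

lemma sets_issues_upto:
  assumes "mc_algorithm m U sel dec"
  shows "{y \<in> space (run_space m U p). \<exists>l\<le>n. issues m sel dec b y l} \<in> sets (run_space m U p)"
proof -
  have "{y \<in> space (run_space m U p). \<exists>l\<le>n. issues m sel dec b y l}
      = (\<Union>l\<in>{..n}. {y \<in> space (run_space m U p). issues m sel dec b y l})"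
    by auto
  then show ?thesis
    using sets_issues[OF assms] by auto
qed

text \<open>
  If the true decisions on all hypotheses agree, then issuing the opposite decision \<open>b\<close> on any
  hypothesis is an error, so the guarantee bounds its probability whichever hypothesis
  the algorithm picks.
\<close>

lemma prob_issues_le:
  assumes alg: "mc_algorithm m U sel dec" and guar: "correctness_guarantee m \<alpha> \<epsilon> U sel dec"
    and p: "\<And>i. i \<in> {1..m} \<Longrightarrow> p i \<in> {0..1}"
    and wrong: "\<And>i. i \<in> {1..m} \<Longrightarrow> b = (i \<notin> stepup_rejected m \<alpha> p)"
  shows "measure (run_space m U p) {y \<in> space (run_space m U p). \<exists>l\<le>n. issues m sel dec b y l} \<le> \<epsilon>"
proof -
  interpret R: prob_space "run_space m U p"
    using alg by (intro prob_space_run_space) (simp add: mc_algorithm_def)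
  let ?W = "{y \<in> space (run_space m U p). wrong_decision m \<alpha> p sel dec y}"
  have "?W = (\<Union>l. {y \<in> space (run_space m U p). issues m sel dec b y l})"
    using wrong by (auto simp: wrong_decision_def issues_def)
  then have "?W \<in> sets (run_space m U p)"
    using sets_issues[OF alg] by auto
  then have "measure (run_space m U p) {y \<in> space (run_space m U p). \<exists>l\<le>n. issues m sel dec b y l}
      \<le> measure (run_space m U p) ?W"
    using wrong by (intro R.finite_measure_mono) (auto simp: wrong_decision_def issues_def)
  also have "\<dots> \<le> \<epsilon>"
    using guar p by (simp add: correctness_guarantee_def)
  finally show ?thesis .
qed

lemma runtime_ge_Suc:
  assumes "1 \<le> k" and no: "\<And>l b. l \<le> n \<Longrightarrow> \<not> issues m sel dec b y l"
  shows "enat (Suc n) \<le> runtime m sel dec k y"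
  unfolding runtime_def
proof (rule INF_greatest)
  fix n' assume "n' \<in> {n. k \<le> card (decided m sel dec y n)}"
  with \<open>1 \<le> k\<close> have "decided m sel dec y n' \<noteq> {}"
    by auto
  then obtain l b where "l \<le> n'" "issues m sel dec b y l"
    by (fastforce simp: decided_def issues_def)
  with no have "n < n'"
    by (metis le_trans not_le)
  then show "enat (Suc n) \<le> enat n'"
    by simp
qed

section \<open>Two extreme cases of the step-up procedure\<close>

lemma set_sorted_pvalues: "set (sort (map p [1..<Suc m])) = p ` {1..m}"
  by (simp add: atLeastLessThanSuc_atLeastAtMost del: upt_Suc)

lemma ordered_pvalue_in_image:
  assumes "j \<in> {1..m}"
  shows "ordered_pvalue m p j \<in> p ` {1..m}"
  unfolding ordered_pvalue_def set_sorted_pvalues[symmetric] using assms by (intro nth_mem) auto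

lemma pvalue_eq_ordered_pvalue:
  assumes "i \<in> {1..m}"
  obtains j where "j \<in> {1..m}" "p i = ordered_pvalue m p j"
proof -
  have "p i \<in> set (sort (map p [1..<Suc m]))"
    unfolding set_sorted_pvalues using assms by (rule imageI)
  then obtain l where "l < length (sort (map p [1..<Suc m]))" "p i = sort (map p [1..<Suc m]) ! l"
    by (metis in_set_conv_nth)
  then show ?thesis
    using that[of "Suc l"] by (auto simp: ordered_pvalue_def simp del: upt_Suc)
qed

lemma pvalue_le_ordered_pvalue_last:
  assumes "i \<in> {1..m}"
  shows "p i \<le> ordered_pvalue m p m"
proof -
  obtain j where j: "j \<in> {1..m}" "p i = ordered_pvalue m p j"
    using assms by (rule pvalue_eq_ordered_pvalue)
  then show ?thesis
    unfolding ordered_pvalue_def by (auto intro: sorted_nth_mono)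
qed

lemma stepup_rejected_all:
  assumes "1 \<le> m" and "\<And>i. i \<in> {1..m} \<Longrightarrow> p i \<le> \<alpha> m"
  shows "stepup_rejected m \<alpha> p = {1..m}"
proof -
  have "ordered_pvalue m p m \<le> \<alpha> m"
  proof -
    obtain i where "i \<in> {1..m}" "ordered_pvalue m p m = p i"
      by (rule imageE[OF ordered_pvalue_in_image[of m m p]]) (use assms(1) in auto)
    with assms(2) show ?thesis
      by simp
  qed
  with assms(1) have mem: "m \<in> {j \<in> {1..m}. ordered_pvalue m p j \<le> \<alpha> j}"
    by simp
  have index: "stepup_index m \<alpha> p = m"
    unfolding stepup_index_def
  proof (rule Max_eqI)
    show "m \<in> insert 0 {j \<in> {1..m}. ordered_pvalue m p j \<le> \<alpha> j}"
      using mem by (rule insertI2)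
  qed auto
  have "\<exists>j\<in>{1..m}. p i = ordered_pvalue m p j" if "i \<in> {1..m}" for i
    by (rule pvalue_eq_ordered_pvalue[OF that, of p]) blast
  then show ?thesis
    unfolding stepup_rejected_def index by blast
qed

text \<open>
  Crossing the last threshold with one p-value removes the index \<open>m\<close>; the smaller indices are
  out of reach because every p-value, hence every ordered p-value, exceeds
  \<open>\<alpha>\<^bsub>m-1\<^esub>\<close>. This is the cascade that makes the decision on each hypothesis depend on one p-value.
\<close>

lemma stepup_rejected_none:
  assumes mono: "strict_mono_on {1..m} \<alpha>"
    and above: "\<And>i. i \<in> {1..m} \<Longrightarrow> \<alpha> (m - 1) < p i"
    and "i \<in> {1..m}" "\<alpha> m < p i"
  shows "stepup_rejected m \<alpha> p = {}"
proof -
  have lt: "\<alpha> j < ordered_pvalue m p j" if j: "j \<in> {1..m}" for j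
  proof (cases "j = m")
    case True
    then show ?thesis
      using pvalue_le_ordered_pvalue_last[OF assms(3), of p] assms(4) by simp
  next
    case False
    with j have "\<alpha> j \<le> \<alpha> (m - 1)"
      by (intro strict_mono_on_leD[OF mono]) auto
    also
    obtain i' where "i' \<in> {1..m}" "ordered_pvalue m p j = p i'"
      using ordered_pvalue_in_image[OF j, of p] by (rule imageE)
    with above have "\<alpha> (m - 1) < ordered_pvalue m p j"
      by simp
    finally show ?thesis .
  qed
  have "{j \<in> {1..m}. ordered_pvalue m p j \<le> \<alpha> j} = {}"
  proof (rule equals0I)
    fix j assume "j \<in> {j \<in> {1..m}. ordered_pvalue m p j \<le> \<alpha> j}"
    with lt[of j] show False
      by simp
  qed
  then have "stepup_index m \<alpha> p = 0"
    by (simp only: stepup_index_def) simp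
  then show ?thesis
    by (simp add: stepup_rejected_def)
qed

section \<open>Divergence of the expected runtime\<close>

lemma nn_integral_inverse_distance:
  fixes a b :: real
  assumes "a < b"
  shows "(\<integral>\<^sup>+x. ennreal (1 / (b - x)) * indicator {a..<b} x \<partial>lborel) = \<infinity>"
proof -
  let ?I = "\<integral>\<^sup>+x. ennreal (1 / (b - x)) * indicator {a..<b} x \<partial>lborel"
  have "of_nat n \<le> ?I" for n :: nat
  proof -
    \<comment> \<open>The integral up to distance \<open>e\<close> from the pole is \<open>ln ((b - a) / e)\<close>, which equals \<open>n\<close>.\<close>
    define e where "e = (b - a) * exp (- real n)"
    have "e \<le> (b - a) * 1"
      unfolding e_def using assms by (intro mult_left_mono) auto
    moreover have "0 < e"
      using assms by (simp add: e_def)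
    moreover define s where "s = b - e"
    ultimately have s: "a \<le> s" "s < b"
      by simp_all
    have "(\<integral>\<^sup>+x. ennreal (1 / (b - x)) * indicator {a..s} x \<partial>lborel)
        = ennreal ((- ln (b - s)) - (- ln (b - a)))"
    proof (rule nn_integral_FTC_Icc)
      fix x assume "x \<in> {a..s}"
      then show "((\<lambda>x. - ln (b - x)) has_field_derivative 1 / (b - x)) (at x)" "0 \<le> 1 / (b - x)"
        using s by (auto intro!: derivative_eq_intros)
    qed (use s in auto)
    also have "(- ln (b - s)) - (- ln (b - a)) = real n"
      using assms by (simp add: s_def e_def ln_mult)
    finally have "of_nat n = (\<integral>\<^sup>+x. ennreal (1 / (b - x)) * indicator {a..s} x \<partial>lborel)"
      by (simp add: ennreal_of_nat_eq_real_of_nat)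
    also have "\<dots> \<le> ?I"
      using s by (intro nn_integral_mono) (auto simp: indicator_def)
    finally show ?thesis .
  qed
  then show ?thesis
    using ennreal_Ex_less_of_nat[of ?I] by (metis infinity_ennreal_def leD top.not_eq_extremum)
qed

text \<open>
  Here \<open>\<delta> = \<alpha>\<^sub>m - p\<^sub>m\<close> and \<open>q\<close> is the reflected vector; the hypothesis \<open>reflect\<close> keeps it inside the unit
  cube. With \<open>c = 1 - 2\<epsilon>\<close>, the horizon \<open>n\<close> is the integer part of \<open>c / (4\<delta>)\<close>, chosen so that the
  coupling costs at most \<open>2n\<delta> \<le> c / 2\<close>. No decision is then issued up to time \<open>n\<close> with probability
  at least \<open>c / 2\<close>, and in that case the runtime is at least \<open>n + 1 \<ge> c / (4\<delta>)\<close>; the product of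
  the two is \<open>c\<^sup>2 / (8\<delta>)\<close>.
\<close>

lemma expected_runtime_given_pvalues_ge:
  assumes alg: "mc_algorithm m U sel dec" and guar: "correctness_guarantee m \<alpha> \<epsilon> U sel dec"
    and mono: "strict_mono_on {1..m} \<alpha>"
    and "\<epsilon> < 1 / 2" "1 \<le> m" "1 \<le> k"
    and p: "\<And>i. i \<in> {1..m} \<Longrightarrow> 0 \<le> p i \<and> \<alpha> (m - 1) < p i \<and> p i < \<alpha> m"
    and reflect: "2 * \<alpha> m - p m \<le> 1"
  shows "ennreal ((1 - 2 * \<epsilon>)\<^sup>2 / 8) * ennreal (1 / (\<alpha> m - p m))
    \<le> (\<integral>\<^sup>+ y. ennreal_of_enat (runtime m sel dec k y) \<partial>run_space m U p)"
proof -
  interpret R: prob_space "run_space m U p"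
    using alg by (intro prob_space_run_space) (simp add: mc_algorithm_def)
  let ?R = "run_space m U p"
  define \<delta> where "\<delta> = \<alpha> m - p m"
  define c where "c = 1 - 2 * \<epsilon>"
  define n where "n = nat \<lfloor>c / (4 * \<delta>)\<rfloor>"
  define q where "q = p(m := \<alpha> m + \<delta>)"
  define N where "N b = {y \<in> space ?R. \<exists>l\<le>n. issues m sel dec b y l}" for b
  have m: "m \<in> {1..m}"
    using \<open>1 \<le> m\<close> by simp
  have "0 < \<delta>"
    using p[OF m] by (simp add: \<delta>_def)
  have "0 < c"
    using \<open>\<epsilon> < 1 / 2\<close> by (simp add: c_def)
  have "0 \<le> c / (4 * \<delta>)"
    using \<open>0 < \<delta>\<close> \<open>0 < c\<close> by simp
  then have n: "real n \<le> c / (4 * \<delta>)" "c / (4 * \<delta>) \<le> real (Suc n)"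
    unfolding n_def by linarith+
  have p01: "p i \<in> {0..1}" if "i \<in> {1..m}" for i
    using p[OF that] p[OF m] reflect by auto
  have q01: "q i \<in> {0..1}" if "i \<in> {1..m}" for i
    using p01[OF that] p[OF m] reflect by (auto simp: q_def \<delta>_def)
  have all: "stepup_rejected m \<alpha> p = {1..m}"
    using p by (intro stepup_rejected_all \<open>1 \<le> m\<close>) (simp add: less_imp_le)
  have none: "stepup_rejected m \<alpha> q = {}"
  proof (rule stepup_rejected_none[OF mono _ m])
    have "\<alpha> (m - 1) < \<alpha> m + \<delta>"
      using p[OF m] \<open>0 < \<delta>\<close> by linarith
    then show "\<alpha> (m - 1) < q i" if "i \<in> {1..m}" for i
      using p[OF that] by (simp add: q_def)
    show "\<alpha> m < q m"
      using \<open>0 < \<delta>\<close> by (simp add: q_def)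
  qed
  have N: "N b \<in> sets ?R" for b
    unfolding N_def by (rule sets_issues_upto[OF alg])
  have False_le: "measure ?R (N False) \<le> \<epsilon>"
    unfolding N_def by (intro prob_issues_le[OF alg guar] p01) (simp_all add: all)
  have "measure ?R (N True)
      \<le> measure (run_space m U q) {y \<in> space (run_space m U q). \<exists>l\<le>n. issues m sel dec True y l}
        + real n * (\<Sum>i\<in>{1..m}. \<bar>p i - q i\<bar>)"
    unfolding N_def
  proof (rule prob_le_after_few_draws[OF _ p01 q01 sets_issues_upto[OF alg]])
    show "prob_space U"
      using alg by (simp add: mc_algorithm_def)
    fix u x x'
    assume "u \<in> space U" and x: "\<And>l i. l < n \<Longrightarrow> i \<in> {1..m} \<Longrightarrow> x (l, i) = x' (l, i)"
      and "\<exists>l\<le>n. issues m sel dec True (u, x) l"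
    then obtain l where l: "l \<le> n" "issues m sel dec True (u, x) l"
      by blast
    have "hist sel (u, x) l = hist sel (u, x') l"
      using l(1) x by (intro hist_cong[OF \<open>u \<in> space U\<close> alg]) auto
    with l show "\<exists>l\<le>n. issues m sel dec True (u, x') l"
      by (auto simp: issues_def)
  qed
  also have "measure (run_space m U q) {y \<in> space (run_space m U q). \<exists>l\<le>n. issues m sel dec True y l} \<le> \<epsilon>"
    by (intro prob_issues_le[OF alg guar] q01) (simp_all add: none)
  also have "(\<Sum>i\<in>{1..m}. \<bar>p i - q i\<bar>) = (\<Sum>i\<in>{1..m}. if i = m then 2 * \<delta> else 0)"
    using \<open>0 < \<delta>\<close> by (intro sum.cong) (auto simp: q_def \<delta>_def)
  also have "\<dots> = 2 * \<delta>"
    using m by simp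
  finally have "measure ?R (N True) \<le> \<epsilon> + real n * (2 * \<delta>)"
    by simp
  also have "real n * (2 * \<delta>) \<le> c / (4 * \<delta>) * (2 * \<delta>)"
    using n(1) \<open>0 < \<delta>\<close> by (intro mult_right_mono) auto
  also have "\<dots> = c / 2"
    using \<open>0 < \<delta>\<close> by (simp add: field_simps)
  finally have "measure ?R (N True) \<le> \<epsilon> + c / 2"
    by simp
  moreover have "measure ?R (N True \<union> N False) \<le> measure ?R (N True) + measure ?R (N False)"
    using N by (intro measure_Un_le)
  moreover have "measure ?R (space ?R - (N True \<union> N False)) = 1 - measure ?R (N True \<union> N False)"
    using N by (intro R.prob_compl) auto
  ultimately have undecided: "c / 2 \<le> measure ?R (space ?R - (N True \<union> N False))"
    using False_le c_def by linarith

  have "(1 - 2 * \<epsilon>)\<^sup>2 / 8 * (1 / (\<alpha> m - p m)) = c / (4 * \<delta>) * (c / 2)"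
    by (simp add: c_def \<delta>_def power2_eq_square)
  also have "\<dots> \<le> real (Suc n) * measure ?R (space ?R - (N True \<union> N False))"
    using n(2) undecided \<open>0 < c\<close> by (intro mult_mono) auto
  finally have "ennreal ((1 - 2 * \<epsilon>)\<^sup>2 / 8 * (1 / (\<alpha> m - p m)))
      \<le> ennreal (real (Suc n) * measure ?R (space ?R - (N True \<union> N False)))"
    by (rule ennreal_leI)
  also have "\<dots> = of_nat (Suc n) * emeasure ?R (space ?R - (N True \<union> N False))"
    by (simp only: R.emeasure_eq_measure ennreal_mult ennreal_of_nat_eq_real_of_nat
        of_nat_0_le_iff measure_nonneg)
  also have "\<dots> = (\<integral>\<^sup>+ y. of_nat (Suc n) * indicator (space ?R - (N True \<union> N False)) y \<partial>?R)"
    using N by (intro nn_integral_cmult_indicator[symmetric]) auto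
  also have "\<dots> \<le> (\<integral>\<^sup>+ y. ennreal_of_enat (runtime m sel dec k y) \<partial>?R)"
  proof (rule nn_integral_mono)
    fix y assume y: "y \<in> space ?R"
    show "of_nat (Suc n) * indicator (space ?R - (N True \<union> N False)) y
        \<le> ennreal_of_enat (runtime m sel dec k y)"
    proof (cases "y \<in> N True \<union> N False")
      case False
      then have "\<not> issues m sel dec b y l" if "l \<le> n" for l b
        using y that by (cases b) (auto simp: N_def)
      then have "enat (Suc n) \<le> runtime m sel dec k y"
        by (rule runtime_ge_Suc[OF \<open>1 \<le> k\<close>])
      then have "ennreal_of_enat (enat (Suc n)) \<le> ennreal_of_enat (runtime m sel dec k y)"
        by (simp only: ennreal_of_enat_le_iff)
      then show ?thesis
        using False y by simp
    qed simp
  qed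
  finally show ?thesis
    using p[OF m] by (subst ennreal_mult[symmetric]) auto
qed

theorem mainTheorem2:
  fixes m k :: nat and \<alpha> :: "nat \<Rightarrow> real" and \<epsilon> \<gamma> d :: real
    and M :: "'a measure" and P :: "'a \<Rightarrow> nat \<Rightarrow> real"
    and f :: "(nat \<Rightarrow> real) \<Rightarrow> real" and F F' :: "real \<Rightarrow> real"
    and U :: "'u measure" and sel :: "'u \<Rightarrow> history \<Rightarrow> nat"
    and dec :: "'u \<Rightarrow> history \<Rightarrow> nat \<Rightarrow> bool option"
  assumes "2 \<le> m"
    and "0 < \<alpha> 1" "strict_mono_on {1..m} \<alpha>" "\<alpha> m < 1"
    and "0 < \<epsilon>" "\<epsilon> < 1 / 2"
    and "prob_space M"
    and "\<And>x. 0 \<le> f x"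
    and "distributed M (\<Pi>\<^sub>M i \<in> {1..m}. lborel) P (\<lambda>x. ennreal (f x))"
    and "measure_support (product_topology (\<lambda>i. euclidean) {1..m})
           (distr M (\<Pi>\<^sub>M i \<in> {1..m}. borel) P) = (\<Pi>\<^sub>E i \<in> {1..m}. {0..1})"
    and "\<And>\<delta>. 0 < \<delta> \<Longrightarrow> \<exists>\<kappa>>0. \<forall>x \<in> (\<Pi>\<^sub>E i \<in> {1..m}. {\<delta>..1 - \<delta>}). \<kappa> < f x"
    and "F = cdf (distr M borel (\<lambda>\<omega>. P \<omega> m))"
    and "(F has_real_derivative F' (\<alpha> m)) (at (\<alpha> m))" "0 < F' (\<alpha> m)"
    and "0 < \<gamma>" "0 < d"
    and "\<And>x. x \<in> {\<alpha> m<..<\<alpha> m + \<gamma>} \<Longrightarrow> (F has_real_derivative F' x) (at x) \<and> d \<le> F' x"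
    and "mc_algorithm m U sel dec"
    and "correctness_guarantee m \<alpha> \<epsilon> U sel dec"
    and "k \<in> {1..m}"
  shows "expected_runtime m M P U sel dec k = \<infinity>"
proof -
  note mono = assms(3) and distributed = assms(9) and density = assms(11)
    and alg = assms(18) and guar = assms(19)
  let ?L = "\<Pi>\<^sub>M i \<in> {1..m}. (lborel :: real measure)"
  have m: "m \<in> {1..m}" and "1 \<le> m"
    using assms(1) by auto
  have "\<alpha> 1 \<le> \<alpha> (m - 1)"
    using assms(1) by (intro strict_mono_on_leD[OF mono]) auto
  then have "0 < \<alpha> (m - 1)"
    using assms(2) by simp
  have "\<alpha> (m - 1) < \<alpha> m"
    using assms(1) by (intro strict_mono_onD[OF mono]) auto
  then have "max (\<alpha> (m - 1)) (2 * \<alpha> m - 1) < \<alpha> m"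
    using assms(4) by simp
  \<comment> \<open>The second lower bound on \<open>a\<close> keeps the reflection of \<open>[a, \<alpha>\<^sub>m)\<close> below 1.\<close>
  then obtain a where a: "\<alpha> (m - 1) < a" "2 * \<alpha> m - 1 < a" "a < \<alpha> m"
    by (metis dense max_less_iff_conj)
  define \<delta> where "\<delta> = min a (1 - \<alpha> m)"
  have "0 < \<delta>"
    using a \<open>0 < \<alpha> (m - 1)\<close> assms(4) by (simp add: \<delta>_def)
  then obtain \<kappa> where "0 < \<kappa>" and \<kappa>: "\<And>x. x \<in> (\<Pi>\<^sub>E i \<in> {1..m}. {\<delta>..1 - \<delta>}) \<Longrightarrow> \<kappa> < f x"
    using density by blast
  define C where "C = (1 - 2 * \<epsilon>)\<^sup>2 / 8"
  have "0 < C"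
    using assms(6) by (simp add: C_def)
  \<comment> \<open>The product of the \<open>g i\<close> is \<open>1 / (\<alpha>\<^sub>m - x\<^sub>m)\<close> on the box and 0 elsewhere. Its integral
    factorises, and up to a constant it is a measurable minorant of the conditional expected
    runtime, so that the integrals compare without measurability of the latter.\<close>
  define g where "g i t = (if i = m then ennreal (1 / (\<alpha> m - t)) else 1) * indicator {a..<\<alpha> m} t"
    for i :: nat and t :: real
  have g[measurable]: "g i \<in> borel_measurable lborel" for i
    unfolding g_def by (cases "i = m") auto
  define G where "G x = (\<Prod>i\<in>{1..m}. g i (x i))" for x
  have G: "G \<in> borel_measurable ?L"
    unfolding G_def
    by (intro borel_measurable_prod_ennreal measurable_compose[OF measurable_component_singleton])
      (auto intro: g)
  have G_box: "G x = ennreal (1 / (\<alpha> m - x m))" if "\<And>i. i \<in> {1..m} \<Longrightarrow> x i \<in> {a..<\<alpha> m}" for x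
  proof -
    have "G x = (\<Prod>i\<in>{1..m}. if i = m then ennreal (1 / (\<alpha> m - x m)) else 1)"
      unfolding G_def using that by (intro prod.cong) (auto simp: g_def)
    then show ?thesis
      using m by simp
  qed
  have G_out: "G x = 0" if "i \<in> {1..m}" "x i \<notin> {a..<\<alpha> m}" for x i
  proof -
    have "g i (x i) = 0"
      using that(2) by (simp add: g_def)
    with that(1) show ?thesis
      unfolding G_def by (intro prod_zero) auto
  qed

  interpret L: product_sigma_finite "\<lambda>_ :: nat. lborel :: real measure"
    by unfold_locales
  have "integral\<^sup>N ?L G = (\<Prod>i\<in>{1..m}. integral\<^sup>N lborel (g i))"
    unfolding G_def by (intro L.product_nn_integral_prod g) simp
  also have "\<dots> = integral\<^sup>N lborel (g m) * (\<Prod>i\<in>{1..m} - {m}. integral\<^sup>N lborel (g i))"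
    using m by (intro prod.remove) auto
  also have "integral\<^sup>N lborel (g m) = \<infinity>"
    using nn_integral_inverse_distance[OF a(3)] by (simp add: g_def[abs_def])
  also have "(\<Prod>i\<in>{1..m} - {m}. integral\<^sup>N lborel (g i)) = (\<Prod>i\<in>{1..m} - {m}. ennreal (\<alpha> m - a))"
    using a by (intro prod.cong) (auto simp: g_def[abs_def])
  also have "\<infinity> * \<dots> = \<infinity>"
    using a by (simp add: ennreal_mult_eq_top_iff ennreal_top_mult prod_ennreal)
  finally have G_infinite: "integral\<^sup>N ?L G = \<infinity>" .

  have "\<infinity> = ennreal (C * \<kappa>) * integral\<^sup>N ?L G"
    unfolding G_infinite using \<open>0 < C\<close> \<open>0 < \<kappa>\<close> by (simp add: ennreal_mult_top)
  also have "\<dots> = (\<integral>\<^sup>+x. ennreal (C * \<kappa>) * G x \<partial>?L)"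
    by (rule nn_integral_cmult[symmetric]) (rule G)
  also have "\<dots> \<le> (\<integral>\<^sup>+x. ennreal (f x) * (ennreal C * G x) \<partial>?L)"
  proof (rule nn_integral_mono)
    fix x assume x: "x \<in> space ?L"
    show "ennreal (C * \<kappa>) * G x \<le> ennreal (f x) * (ennreal C * G x)"
    proof (cases "\<forall>i\<in>{1..m}. x i \<in> {a..<\<alpha> m}")
      case True
      then have "x \<in> (\<Pi>\<^sub>E i \<in> {1..m}. {\<delta>..1 - \<delta>})"
      proof (intro PiE_I)
        fix i assume "i \<in> {1..m}"
        with True have "a \<le> x i" "x i < \<alpha> m"
          by auto
        then show "x i \<in> {\<delta>..1 - \<delta>}"
          by (simp add: \<delta>_def min_def)
      next
        fix i assume "i \<notin> {1..m}"
        then show "x i = undefined"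
          using x PiE_arb[of x "{1..m}" "\<lambda>_. UNIV" i] by (simp add: space_PiM)
      qed
      then have "C * \<kappa> \<le> f x * C"
        using \<kappa>[of x] \<open>0 < C\<close> by simp
      then have "ennreal (C * \<kappa>) * G x \<le> ennreal (f x * C) * G x"
        by (intro mult_right_mono ennreal_leI) auto
      then show ?thesis
        using assms(8) \<open>0 < C\<close> by (simp add: ennreal_mult mult.assoc)
    next
      case False
      then have "G x = 0"
        using G_out by blast
      then show ?thesis
        by simp
    qed
  qed
  also have "\<dots> = (\<integral>\<^sup>+\<omega>. ennreal C * G (P \<omega>) \<partial>M)"
    by (rule distributed_nn_integral[OF distributed borel_measurable_times_ennreal[OF borel_measurable_const G]])
  also have "\<dots> \<le> expected_runtime m M P U sel dec k"
    unfolding expected_runtime_def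
  proof (rule nn_integral_mono)
    fix \<omega>
    show "ennreal C * G (P \<omega>)
        \<le> (\<integral>\<^sup>+ y. ennreal_of_enat (runtime m sel dec k y) \<partial>run_space m U (P \<omega>))"
    proof (cases "\<forall>i\<in>{1..m}. P \<omega> i \<in> {a..<\<alpha> m}")
      case True
      then have P: "a \<le> P \<omega> i" "P \<omega> i < \<alpha> m" if "i \<in> {1..m}" for i
        using that by auto
      have "ennreal C * ennreal (1 / (\<alpha> m - P \<omega> m))
          \<le> (\<integral>\<^sup>+ y. ennreal_of_enat (runtime m sel dec k y) \<partial>run_space m U (P \<omega>))"
        unfolding C_def
      proof (rule expected_runtime_given_pvalues_ge[OF alg guar mono assms(6) \<open>1 \<le> m\<close>])
        show "1 \<le> k"
          using assms(20) by simp
        show "0 \<le> P \<omega> i \<and> \<alpha> (m - 1) < P \<omega> i \<and> P \<omega> i < \<alpha> m" if "i \<in> {1..m}" for i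
          using P[OF that] a(1) \<open>0 < \<alpha> (m - 1)\<close> by linarith
        show "2 * \<alpha> m - P \<omega> m \<le> 1"
          using P[OF m] a(2) by linarith
      qed
      then show ?thesis
        using G_box[of "P \<omega>"] True by simp
    next
      case False
      then have "G (P \<omega>) = 0"
        using G_out by blast
      then show ?thesis
        by simp
    qed
  qed
  finally show ?thesis
    by (simp add: top_unique)
qed

end
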